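(* For all $n\ge1$, \[|\mathrm{Av}^\star_{3n}(321)|=\sum_{D\in\mathcal{D}_n}2^{h(D)}\prod_{i=1}^{n-1}\binom{r_i(D)+s_i(D)}{r_i(D)},\] where $\mathcal{D}_n$ is the set of Dyck words on $\{x,y\}$ of semilength $n$, $h(D)$ is the number of nonempty initial segments (prefixes) of $D$ with equal numbers of $x$'s and $y$'s, $r_i(D)$ is the number of $y$'s between the $i$-th and $(i+1)$-st $x$ of $D$, and $s_i(D)$ is the number of $x$'s between the $i$-th and $(i+1)$-st $y$ of $D$.
   Context: Permutations are written in one-line notation; a permutation avoids $\sigma$ if no subsequence is in the same relative order as $\sigma$. $\mathcal{S}^\star_{3n}$ is the set of permutations of $[3n]$ whose cycle decomposition consists only of 3-cycles, and $\mathrm{Av}^\star_{3n}(321)$ the set of those avoiding 321. A Dyck word on $\{x,y\}$ of semilength $n$ is a word with $n$ $x$'s and $n$ $y$'s in which every prefix contains at least as many $x$'s as $y$'s. *)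

theory Defs
  imports "HOL-Combinatorics.Permutations" "HOL-Combinatorics.Orbits" "HOL-Library.Sublist"
begin

definition one_line :: "nat \<Rightarrow> (nat \<Rightarrow> nat) \<Rightarrow> nat list" where
  "one_line N p = map p [1..<Suc N]"

definition same_relative_order :: "nat list \<Rightarrow> nat list \<Rightarrow> bool" where
  "same_relative_order xs ys \<longleftrightarrow> length xs = length ys \<and>
     (\<forall>i < length xs. \<forall>j < length xs. xs ! i < xs ! j \<longleftrightarrow> ys ! i < ys ! j)"

definition avoids :: "nat list \<Rightarrow> nat list \<Rightarrow> bool" where
  "avoids xs \<sigma> \<longleftrightarrow> \<not> (\<exists>ys. subseq ys xs \<and> same_relative_order ys \<sigma>)"

(* The cycle of p through x has length card (orbit p x); fixed points count as 1-cycles. *)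
definition perms_three_cycles :: "nat \<Rightarrow> (nat \<Rightarrow> nat) set" where
  "perms_three_cycles N = {p. p permutes {1..N} \<and> (\<forall>x \<in> {1..N}. card (orbit p x) = 3)}"

definition Av_three_cycles :: "nat \<Rightarrow> nat list \<Rightarrow> (nat \<Rightarrow> nat) set" where
  "Av_three_cycles N \<sigma> = {p \<in> perms_three_cycles N. avoids (one_line N p) \<sigma>}"

datatype letter = X | Y

definition dyck_words :: "nat \<Rightarrow> letter list set" where
  "dyck_words n = {D. count_list D X = n \<and> count_list D Y = n \<and>
     (\<forall>P. prefix P D \<longrightarrow> count_list P Y \<le> count_list P X)}"

definition dyck_h :: "letter list \<Rightarrow> nat" where
  "dyck_h D = card {P. prefix P D \<and> P \<noteq> [] \<and> count_list P X = count_list P Y}"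

(* The 0-based position in D of the i-th occurrence of a, where i = 1, 2, ... *)
definition occ :: "letter \<Rightarrow> nat \<Rightarrow> letter list \<Rightarrow> nat" where
  "occ a i D = filter (\<lambda>k. D ! k = a) [0..<length D] ! (i - 1)"

definition dyck_r :: "nat \<Rightarrow> letter list \<Rightarrow> nat" where
  "dyck_r i D = card {k. occ X i D < k \<and> k < occ X (i + 1) D \<and> D ! k = Y}"

definition dyck_s :: "nat \<Rightarrow> letter list \<Rightarrow> nat" where
  "dyck_s i D = card {k. occ Y i D < k \<and> k < occ Y (i + 1) D \<and> D ! k = X}"

end

theory Submission
  imports Defs
begin

text \<open>
  A fixed-point-free permutation avoids 321 iff its excedances and its deficiencies are both
  increasing. Comparing two 3-cycles of such a permutation shows that the cycles can be numbered so
  that their minima \<open>a\<^sub>i\<close>, middle elements \<open>b\<^sub>i\<close> and maxima \<open>c\<^sub>i\<close> all increase with \<open>i\<close>, and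
  that \<open>a\<^sub>i < b\<^sub>j\<close> iff \<open>b\<^sub>i < c\<^sub>j\<close>. Hence, in the word recording the role of each point, the \<open>a,b\<close>-subword
  and the \<open>b,c\<close>-subword are the same Dyck word \<open>D\<close>. Two cycles may run in different
  directions (\<open>a\<close> to \<open>b\<close> to \<open>c\<close> to \<open>a\<close> or the reverse) exactly when a return of \<open>D\<close> separates them, so
  the directions can be chosen in \<open>2\<^sup>h\<close> ways. A word with both subwords equal to \<open>D\<close> amounts to a
  shuffle, between consecutive \<open>b\<close>'s, of \<open>s\<^sub>i\<close> letters \<open>a\<close> with \<open>r\<^sub>i\<close> letters \<open>c\<close>, which gives the
  binomial coefficients.
\<close>

section \<open>Occurrences of letters in words\<close>

text \<open>A recursive counterpart of \<open>occ\<close>, made for induction on the word.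
  Occurrences are numbered from 0 here, so \<open>pos a i\<close> corresponds to
  \<open>occ a (Suc i)\<close>; if there is no such occurrence the value is the length of the
  word.\<close>

fun pos :: "'a \<Rightarrow> nat \<Rightarrow> 'a list \<Rightarrow> nat" where
  "pos a i [] = 0"
| "pos a i (x # xs) =
    (if x = a then (case i of 0 \<Rightarrow> 0 | Suc j \<Rightarrow> Suc (pos a j xs)) else Suc (pos a i xs))"

lemma pos_less_length: "i < count_list xs a \<Longrightarrow> pos a i xs < length xs"
  by (induction xs arbitrary: i) (auto split: nat.splits)

lemma nth_pos: "i < count_list xs a \<Longrightarrow> xs ! pos a i xs = a"
  by (induction xs arbitrary: i) (auto split: nat.splits)

lemma pos_mono: "i < j \<Longrightarrow> j < count_list xs a \<Longrightarrow> pos a i xs < pos a j xs"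
  by (induction xs arbitrary: i j) (auto split: nat.splits)

lemma pos_less_iff:
  "i < count_list xs a \<Longrightarrow> j < count_list xs a \<Longrightarrow> pos a i xs < pos a j xs \<longleftrightarrow> i < j"
  by (metis linorder_cases order_less_imp_not_less pos_mono)

lemma pos_le_iff:
  "i < count_list xs a \<Longrightarrow> j < count_list xs a \<Longrightarrow> pos a i xs \<le> pos a j xs \<longleftrightarrow> i \<le> j"
  by (meson linorder_not_less pos_less_iff)

lemma pos_eq_iff:
  assumes "i < count_list xs a" "j < count_list xs b"
  shows "pos a i xs = pos b j xs \<longleftrightarrow> a = b \<and> i = j"
  using assms by (metis nth_pos linorder_cases order_less_irrefl pos_mono)

text \<open>Together with \<open>pos_eq_iff\<close> this makes (letter, index) a system of
  coordinates for the positions of a word.\<close>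

lemma pos_onto: "k < length xs \<Longrightarrow> \<exists>i < count_list xs (xs ! k). k = pos (xs ! k) i xs"
proof (induction xs arbitrary: k)
  case (Cons x xs)
  show ?case
  proof (cases k)
    case 0
    then show ?thesis by (auto intro!: exI[of _ 0])
  next
    case (Suc m)
    then obtain i where i: "i < count_list xs (xs ! m)" "m = pos (xs ! m) i xs"
      using Cons by auto
    show ?thesis
    proof (cases "x = xs ! m")
      case True
      then show ?thesis using i Suc by (intro exI[of _ "Suc i"]) auto
    next
      case False
      then show ?thesis using i Suc by (intro exI[of _ i]) auto
    qed
  qed
qed simp

text \<open>The bridge between the two languages used for Dyck words: letter counts in prefixes and
  inequalities between positions.\<close>

lemma less_count_take_iff:
  "i < count_list xs a \<Longrightarrow> i < count_list (take k xs) a \<longleftrightarrow> pos a i xs < k"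
proof (induction xs arbitrary: i k)
  case (Cons x xs)
  show ?case
    using Cons.prems Cons.IH[of _ "k - 1"] by (cases k; cases i) auto
qed simp

lemma filter_upt_Cons:
  "filter (\<lambda>k. (x # xs) ! k = a) [0..<length (x # xs)] =
    (if x = a then [0] else []) @ map Suc (filter (\<lambda>k. xs ! k = a) [0..<length xs])"
proof -
  have "[0..<length (x # xs)] = 0 # map Suc [0..<length xs]"
    by (simp add: upt_conv_Cons map_Suc_upt del: upt_Suc)
  then show ?thesis by (simp add: filter_map o_def del: upt_Suc)
qed

lemma length_filter_upt_nth:
  "length (filter (\<lambda>k. xs ! k = a) [0..<length xs]) = count_list xs a"
proof (induction xs)
  case (Cons x xs)
  then show ?case unfolding filter_upt_Cons by simp
qed simp

lemma nth_filter_upt_pos: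
  "i < count_list xs a \<Longrightarrow> filter (\<lambda>k. xs ! k = a) [0..<length xs] ! i = pos a i xs"
proof (induction xs arbitrary: i)
  case (Cons x xs)
  show ?case
    unfolding filter_upt_Cons using Cons
    by (cases i) (auto simp: length_filter_upt_nth)
qed simp

lemma occ_eq_pos: "i < count_list D a \<Longrightarrow> occ a (Suc i) D = pos a i D"
  by (simp add: occ_def nth_filter_upt_pos)

\<comment> \<open>Lengths of the runs delimited by the occurrences of \<open>a\<close>, including the first and the last run.\<close>
fun gaps :: "'a \<Rightarrow> 'a list \<Rightarrow> nat list" where
  "gaps a [] = [0]"
| "gaps a (x # xs) =
    (if x = a then 0 # gaps a xs else Suc (hd (gaps a xs)) # tl (gaps a xs))"

lemma gaps_neq_Nil [simp]: "gaps a xs \<noteq> []"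
  by (cases xs) auto

lemma length_gaps [simp]: "length (gaps a xs) = Suc (count_list xs a)"
  by (induction xs) auto

lemma nth_gaps_Cons:
  "gaps a (x # xs) ! i = (if x = a then (case i of 0 \<Rightarrow> 0 | Suc j \<Rightarrow> gaps a xs ! j)
     else if i = 0 then Suc (gaps a xs ! 0) else gaps a xs ! i)"
  by (cases "gaps a xs"; cases i) auto

lemma pos_0_gaps: "0 < count_list xs a \<Longrightarrow> pos a 0 xs = gaps a xs ! 0"
  by (induction xs) (auto simp: nth_gaps_Cons simp del: gaps.simps(2))

lemma pos_Suc_gaps:
  "Suc i < count_list xs a \<Longrightarrow> pos a (Suc i) xs = Suc (pos a i xs + gaps a xs ! Suc i)"
proof (induction xs arbitrary: i)
  case (Cons x xs)
  then show ?case
    by (cases i) (auto simp: nth_gaps_Cons pos_0_gaps simp del: gaps.simps(2))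
qed simp

lemma length_gaps_0: "count_list xs a = 0 \<Longrightarrow> length xs = gaps a xs ! 0"
  by (induction xs) (auto simp: nth_gaps_Cons simp del: gaps.simps(2) split: if_splits)

lemma length_gaps_last:
  "count_list xs a = Suc i \<Longrightarrow> length xs = Suc (pos a i xs + gaps a xs ! Suc i)"
proof (induction xs arbitrary: i)
  case (Cons x xs)
  then show ?case
    by (cases i) (auto simp: nth_gaps_Cons length_gaps_0 simp del: gaps.simps(2) split: if_splits)
qed simp

lemma card_between_pos:
  assumes "Suc i < count_list xs a"
  shows "card {k. pos a i xs < k \<and> k < pos a (Suc i) xs} = gaps a xs ! Suc i"
proof -
  have "{k. pos a i xs < k \<and> k < pos a (Suc i) xs} = {pos a i xs<..<pos a (Suc i) xs}" by auto
  then show ?thesis by (simp add: pos_Suc_gaps[OF assms])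
qed

lemma nth_between_pos:
  assumes "Suc i < count_list xs a" "pos a i xs < k" "k < pos a (Suc i) xs"
  shows "xs ! k \<noteq> a"
proof
  assume "xs ! k = a"
  moreover have "k < length xs" using assms pos_less_length less_trans by metis
  ultimately obtain j where "j < count_list xs a" "k = pos a j xs" using pos_onto by metis
  then show False using assms by (auto simp: pos_less_iff)
qed

lemma letter_neq_iff: "l \<noteq> X \<longleftrightarrow> l = Y" "l \<noteq> Y \<longleftrightarrow> l = X"
  by (cases l; simp)+

text \<open>Every letter strictly between consecutive \<open>X\<close>'s is a \<open>Y\<close>, so
  counting the \<open>Y\<close>'s there measures the whole run.\<close>

lemma dyck_r_gaps: "Suc i < count_list D X \<Longrightarrow> dyck_r (Suc i) D = gaps X D ! Suc i"
  unfolding dyck_r_def using nth_between_pos[of i D X]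
  by (subst card_between_pos[symmetric])
    (auto simp: occ_eq_pos letter_neq_iff intro!: arg_cong[where f = card])

lemma dyck_s_gaps: "Suc i < count_list D Y \<Longrightarrow> dyck_s (Suc i) D = gaps Y D ! Suc i"
  unfolding dyck_s_def using nth_between_pos[of i D Y]
  by (subst card_between_pos[symmetric])
    (auto simp: occ_eq_pos letter_neq_iff intro!: arg_cong[where f = card])

section \<open>Dyck words\<close>

lemma finite_dyck_words: "finite (dyck_words n)"
proof -
  have "length D = count_list D X + count_list D Y" for D
    by (induction D) (auto simp: letter_neq_iff)
  then have "dyck_words n \<subseteq> {D. set D \<subseteq> {X, Y} \<and> length D = n + n}"
    by (auto simp: dyck_words_def letter_neq_iff)
  then show ?thesis by (rule finite_subset) (simp add: finite_lists_length_eq)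
qed

text \<open>The Dyck condition is tightest at prefixes that end with a \<open>Y\<close>; there it
  says that the \<open>X\<close> of the same index has already occurred.\<close>

lemma dyck_words_iff:
  "D \<in> dyck_words n \<longleftrightarrow> count_list D X = n \<and> count_list D Y = n \<and> (\<forall>i<n. pos X i D < pos Y i D)"
proof
  assume D: "D \<in> dyck_words n"
  then have cnt: "count_list D X = n" "count_list D Y = n" by (auto simp: dyck_words_def)
  have "pos X i D < pos Y i D" if "i < n" for i
  proof -
    let ?P = "take (Suc (pos Y i D)) D"
    have "i < count_list ?P Y" using that cnt by (simp add: less_count_take_iff)
    also have "\<dots> \<le> count_list ?P X" using D by (auto simp: dyck_words_def take_is_prefix)
    finally have "pos X i D \<le> pos Y i D" using that cnt by (simp add: less_count_take_iff)
    then show ?thesis using that cnt pos_eq_iff[of i D X i Y] by auto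
  qed
  then show "count_list D X = n \<and> count_list D Y = n \<and> (\<forall>i<n. pos X i D < pos Y i D)"
    using cnt by blast
next
  assume "count_list D X = n \<and> count_list D Y = n \<and> (\<forall>i<n. pos X i D < pos Y i D)"
  then have cnt: "count_list D X = n" "count_list D Y = n"
    and less: "\<forall>i<n. pos X i D < pos Y i D" by auto
  have "count_list P Y \<le> count_list P X" if "prefix P D" for P
  proof (rule ccontr)
    assume neg: "\<not> count_list P Y \<le> count_list P X"
    obtain k where k: "P = take k D" using \<open>prefix P D\<close> by (metis append_eq_conv_conj prefix_def)
    \<comment> \<open>The \<open>Y\<close> with this index lies inside the offending prefix, while
      the \<open>X\<close> with this index lies outside.\<close>
    let ?i = "count_list P X"
    have "count_list P Y \<le> n" using \<open>prefix P D\<close> cnt by (auto simp: prefix_def)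
    then have "?i < n" using neg by simp
    moreover have "pos Y ?i D < k"
      using neg less_count_take_iff[of ?i D Y k] cnt \<open>?i < n\<close> k by simp
    ultimately have "pos X ?i D < k" using less less_trans by blast
    then show False using less_count_take_iff[of ?i D X k] cnt \<open>?i < n\<close> k by simp
  qed
  then show "D \<in> dyck_words n" using cnt by (auto simp: dyck_words_def)
qed

text \<open>Equal letters are ordered by their indices anyway, so beyond the counts only the
  comparisons of an \<open>X\<close> with a \<open>Y\<close> carry information.\<close>

lemma letter_list_eqI:
  assumes "count_list U X = count_list V X" "count_list U Y = count_list V Y"
    and "\<And>i j. i < count_list U X \<Longrightarrow> j < count_list U Y \<Longrightarrow>
      pos X i U < pos Y j U \<longleftrightarrow> pos X i V < pos Y j V"
  shows "U = V"
  using assms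
proof (induction U arbitrary: V)
  case Nil
  then show ?case by (cases V rule: list.exhaust; cases "hd V") auto
next
  case (Cons u U)
  show ?case
  proof (cases V)
    case Nil
    then show ?thesis using Cons.prems(1,2) by (cases u) auto
  next
    case V: (Cons v V')
    have "u = v"
    proof (rule ccontr)
      assume "u \<noteq> v"
      \<comment> \<open>By the equal counts both letters occur in both words, and comparing the
        first \<open>X\<close> with the first \<open>Y\<close> reveals the initial letter.\<close>
      then show False
        using Cons.prems(1,2) Cons.prems(3)[of 0 0] V by (cases u; cases v) auto
    qed
    moreover have "U = V'"
    proof (rule Cons.IH)
      fix i j assume ij: "i < count_list U X" "j < count_list U Y"
      show "pos X i U < pos Y j U \<longleftrightarrow> pos X i V' < pos Y j V'"
        using Cons.prems(3)[of "if u = X then Suc i else i" "if u = Y then Suc j else j"] ij V \<open>u = v\<close>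
        by (cases u) auto
    qed (use Cons.prems V \<open>u = v\<close> in \<open>auto split: if_splits\<close>)
    ultimately show ?thesis using V by simp
  qed
qed

text \<open>A nonempty Dyck word begins with \<open>X\<close> and ends with \<open>Y\<close>, which
  empties these two outer runs.\<close>

lemma dyck_gaps_ends:
  assumes "D \<in> dyck_words n" "0 < n"
  shows "gaps X D ! 0 = 0" "gaps Y D ! n = 0"
proof -
  have cnt: "count_list D X = n" "count_list D Y = n" and less: "\<And>i. i < n \<Longrightarrow> pos X i D < pos Y i D"
    using assms by (auto simp: dyck_words_iff)
  have exh: "\<exists>i<n. k = pos X i D \<or> k = pos Y i D" if "k < length D" for k
    using pos_onto[OF that] cnt by (cases "D ! k") auto
  have len: "pos Y (n - 1) D < length D" using assms cnt by (simp add: pos_less_length)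
  have low: "pos X 0 D \<le> pos X i D" "pos X 0 D \<le> pos Y i D" if "i < n" for i
  proof -
    show "pos X 0 D \<le> pos X i D" using that cnt by (simp add: pos_le_iff)
    then show "pos X 0 D \<le> pos Y i D" using less[OF that] by simp
  qed
  obtain i where "i < n" "0 = pos X i D \<or> 0 = pos Y i D" using exh[of 0] len by fastforce
  then have "pos X 0 D = 0" using low[of i] by auto
  then show "gaps X D ! 0 = 0" using assms(2) cnt pos_0_gaps[of D X] by simp
  have high: "pos X i D \<le> pos Y (n - 1) D" "pos Y i D \<le> pos Y (n - 1) D" if "i < n" for i
  proof -
    show "pos Y i D \<le> pos Y (n - 1) D" using that cnt by (simp add: pos_le_iff)
    then show "pos X i D \<le> pos Y (n - 1) D" using less[OF that] by simp
  qed
  obtain j where "j < n" "length D - 1 = pos X j D \<or> length D - 1 = pos Y j D"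
    using exh[of "length D - 1"] len by fastforce
  then have "length D - 1 \<le> pos Y (n - 1) D" using high[of j] by auto
  then show "gaps Y D ! n = 0"
    using length_gaps_last[of D Y "n - 1"] cnt assms by simp
qed

text \<open>A balanced prefix is determined by its number of \<open>X\<close>'s. The value
  \<open>n\<close> belongs to the whole word and accounts for the \<open>Suc\<close>; a value
  \<open>Suc i < n\<close> means that the \<open>Y\<close> of index \<open>i\<close> precedes the
  next \<open>X\<close>.\<close>

lemma dyck_h_conv:
  assumes D: "D \<in> dyck_words n" and "0 < n"
  shows "dyck_h D = Suc (card {i. Suc i < n \<and> pos Y i D < pos X (Suc i) D})"
proof -
  have cnt: "count_list D X = n" "count_list D Y = n" and less: "\<And>i. i < n \<Longrightarrow> pos X i D < pos Y i D"
    using D by (auto simp: dyck_words_iff)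
  have len: "length P = count_list P X + count_list P Y" for P
    by (induction P) (auto simp: letter_neq_iff)
  let ?B = "{P. prefix P D \<and> P \<noteq> [] \<and> count_list P X = count_list P Y}"
  let ?R = "{i. Suc i < n \<and> pos Y i D < pos X (Suc i) D}"
  let ?f = "\<lambda>P. count_list P X"
  have "inj_on ?f ?B"
  proof (rule inj_onI)
    fix P Q assume PQ: "P \<in> ?B" "Q \<in> ?B" "count_list P X = count_list Q X"
    then have "length P = length Q" using len[of P] len[of Q] by simp
    moreover have "prefix P D" "prefix Q D" using PQ by auto
    ultimately show "P = Q" by (metis prefix_length_prefix prefix_order.antisym order_refl)
  qed
  moreover have "?f ` ?B = insert n (Suc ` ?R)"
  proof (intro equalityI subsetI)
    fix m assume "m \<in> ?f ` ?B"
    then obtain P where P: "prefix P D" "P \<noteq> []" "count_list P X = m" "count_list P Y = m" by auto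
    obtain k where k: "P = take k D" using \<open>prefix P D\<close> by (metis append_eq_conv_conj prefix_def)
    have "m \<le> n" using P cnt by (auto simp: prefix_def)
    have "0 < m" using P len[of P] by (cases m) auto
    show "m \<in> insert n (Suc ` ?R)"
    proof (cases "m = n")
      case False
      then have "m < n" using \<open>m \<le> n\<close> by simp
      then have "pos Y (m - 1) D < k" "\<not> pos X m D < k"
        using less_count_take_iff[of "m - 1" D Y k] less_count_take_iff[of m D X k] P k cnt \<open>0 < m\<close>
        by auto
      then have "m - 1 \<in> ?R" using \<open>m < n\<close> \<open>0 < m\<close> by simp
      then show ?thesis using \<open>0 < m\<close> by (intro insertI2 image_eqI[of _ _ "m - 1"]) simp_all
    qed simp
  next
    fix m assume "m \<in> insert n (Suc ` ?R)"
    then consider "m = n" | i where "m = Suc i" "i \<in> ?R" by auto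
    then show "m \<in> ?f ` ?B"
    proof cases
      case 1
      then show ?thesis using cnt \<open>0 < n\<close> by (intro image_eqI[of _ _ D]) auto
    next
      case 2
      \<comment> \<open>The prefix is cut directly before the \<open>X\<close> that follows the
        return.\<close>
      let ?k = "pos X (Suc i) D"
      let ?P = "take ?k D"
      have i: "Suc i < n" "pos Y i D < ?k" using 2 by auto
      have "i < count_list ?P Y" using i cnt by (simp add: less_count_take_iff)
      moreover have "\<not> Suc i < count_list ?P Y"
        using i cnt less[of "Suc i"] by (simp add: less_count_take_iff)
      moreover have "i < count_list ?P X" using i cnt by (simp add: less_count_take_iff pos_mono)
      moreover have "\<not> Suc i < count_list ?P X" using i cnt by (simp add: less_count_take_iff)
      ultimately have "count_list ?P X = m" "count_list ?P Y = m" using 2 by auto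
      moreover have "?P \<noteq> []" using \<open>i < count_list ?P X\<close> by (metis count_list.simps(1) not_less0)
      ultimately show ?thesis by (intro image_eqI[of _ _ ?P]) (auto simp: take_is_prefix)
    qed
  qed
  moreover have "finite ?R" by (rule finite_subset[of _ "{..<n}"]) auto
  then have "card (insert n (Suc ` ?R)) = Suc (card ?R)"
    by (subst card_insert_disjoint) (auto simp: card_image)
  ultimately show ?thesis unfolding dyck_h_def using card_image[of ?f ?B] by simp
qed

section \<open>Choices of direction\<close>

text \<open>These are the unions of blocks into which \<open>R\<close> cuts \<open>{..<n}\<close>. A
  block will be a run of cycles forced to share their direction.\<close>

definition switchings :: "nat \<Rightarrow> nat set \<Rightarrow> nat set set" where
  "switchings n R = {T. T \<subseteq> {..<n} \<and> (\<forall>i. Suc i < n \<longrightarrow> i \<notin> R \<longrightarrow> (i \<in> T \<longleftrightarrow> Suc i \<in> T))}"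

lemma finite_switchings: "finite (switchings n R)"
  by (rule finite_subset[of _ "Pow {..<n}"]) (auto simp: switchings_def)

text \<open>Induction on the last point: after a cut its membership is free, which doubles the
  count; otherwise it copies that of its predecessor. The remaining factor 2 is the choice for the
  first block.\<close>

lemma card_switchings: "card (switchings (Suc n) R) = 2 ^ Suc (card {i. i < n \<and> i \<in> R})"
proof (induction n)
  case 0
  have "switchings (Suc 0) R = Pow {0}" by (auto simp: switchings_def)
  then show ?case by (simp add: card_Pow)
next
  case (Suc n)
  let ?S = "switchings (Suc n) R"
  let ?ins = "insert (Suc n)"
  have sub: "Suc n \<notin> T" if "T \<in> ?S" for T using that by (auto simp: switchings_def)
  \<comment> \<open>A switching restricts to one on the shorter interval, and the only new
    constraint links \<open>n\<close> with \<open>Suc n\<close>.\<close>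
  have ext: "T \<in> switchings (Suc (Suc n)) R \<longleftrightarrow>
      T - {Suc n} \<in> ?S \<and> (n \<notin> R \<longrightarrow> (n \<in> T \<longleftrightarrow> Suc n \<in> T))" for T
  proof -
    have 1: "T \<subseteq> {..<Suc (Suc n)} \<longleftrightarrow> T - {Suc n} \<subseteq> {..<Suc n}"
      unfolding lessThan_Suc[of "Suc n"] by blast
    have 2: "(\<forall>i. Suc i < Suc (Suc n) \<longrightarrow> Q i) \<longleftrightarrow> (\<forall>i. Suc i < Suc n \<longrightarrow> Q i) \<and> Q n" for Q
      unfolding less_Suc_eq[of _ "Suc n"] by blast
    have 3: "(\<forall>i. Suc i < Suc n \<longrightarrow> i \<notin> R \<longrightarrow> (i \<in> T - {Suc n} \<longleftrightarrow> Suc i \<in> T - {Suc n})) \<longleftrightarrow>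
        (\<forall>i. Suc i < Suc n \<longrightarrow> i \<notin> R \<longrightarrow> (i \<in> T \<longleftrightarrow> Suc i \<in> T))"
      by auto
    show ?thesis unfolding switchings_def mem_Collect_eq 1 2 3 by (simp only: conj_assoc)
  qed
  show ?case
  proof (cases "n \<in> R")
    case True
    have "switchings (Suc (Suc n)) R = ?S \<union> ?ins ` ?S"
    proof (intro equalityI subsetI)
      fix T assume "T \<in> switchings (Suc (Suc n)) R"
      then have "T - {Suc n} \<in> ?S" using ext by blast
      then show "T \<in> ?S \<union> ?ins ` ?S"
        by (cases "Suc n \<in> T") (auto simp: insert_absorb intro!: image_eqI[of _ _ "T - {Suc n}"])
    next
      fix T assume "T \<in> ?S \<union> ?ins ` ?S"
      then obtain S where S: "S \<in> ?S" "T = S \<or> T = ?ins S" by blast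
      then have "T - {Suc n} = S" using sub[OF S(1)] by blast
      then show "T \<in> switchings (Suc (Suc n)) R" using ext[of T] S(1) True by simp
    qed
    also have "card \<dots> = card ?S + card (?ins ` ?S)"
      using sub by (intro card_Un_disjoint finite_imageI finite_switchings) blast
    also have "card (?ins ` ?S) = card ?S"
    proof (rule card_image, rule inj_onI)
      fix T T' assume "T \<in> ?S" "T' \<in> ?S" "?ins T = ?ins T'"
      then show "T = T'" using sub[of T] sub[of T'] by (metis insert_ident)
    qed
    finally have "card (switchings (Suc (Suc n)) R) = 2 * card ?S" by simp
    moreover have "{i. i < Suc n \<and> i \<in> R} = insert n {i. i < n \<and> i \<in> R}"
      using True by auto
    ultimately show ?thesis using Suc by simp
  next
    case False
    let ?f = "\<lambda>T. if n \<in> T then ?ins T else T"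
    have "?f T - {Suc n} = T" if "T \<in> ?S" for T
      using sub[OF that] by auto
    moreover from this have "?f T \<in> switchings (Suc (Suc n)) R" if "T \<in> ?S" for T
      using that sub[OF that] ext[of "?f T"] by auto
    moreover have "T - {Suc n} \<in> ?S" "?f (T - {Suc n}) = T" if "T \<in> switchings (Suc (Suc n)) R" for T
      using that False ext[of T] by (auto simp: insert_absorb)
    ultimately have "bij_betw ?f ?S (switchings (Suc (Suc n)) R)"
      by (intro bij_betw_byWitness[where f' = "\<lambda>T. T - {Suc n}"]) blast+
    then have "card ?S = card (switchings (Suc (Suc n)) R)" by (rule bij_betw_same_card)
    moreover have "{i. i < Suc n \<and> i \<in> R} = {i. i < n \<and> i \<in> R}"
      using False less_Suc_eq by auto
    ultimately show ?thesis using Suc by simp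
  qed
qed

section \<open>Words with prescribed subwords\<close>

\<comment> \<open>The role of a point in its 3-cycle: minimum, middle element or maximum.\<close>
datatype role = Lo | Mi | Hi

text \<open>A middle element closes against the minima, hence \<open>Y\<close> here, and opens
  against the maxima, hence \<open>X\<close> in \<open>mihi\<close>.\<close>

fun lomi :: "role list \<Rightarrow> letter list" where
  "lomi [] = []"
| "lomi (Lo # w) = X # lomi w"
| "lomi (Mi # w) = Y # lomi w"
| "lomi (Hi # w) = lomi w"

fun mihi :: "role list \<Rightarrow> letter list" where
  "mihi [] = []"
| "mihi (Lo # w) = mihi w"
| "mihi (Mi # w) = X # mihi w"
| "mihi (Hi # w) = Y # mihi w"

text \<open>Two independent subwords are allowed, although only \<open>merges D D\<close> is counted
  in the end, because removing a first letter destroys equality.\<close>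

definition merges :: "letter list \<Rightarrow> letter list \<Rightarrow> role list set" where
  "merges U V = {w. lomi w = U \<and> mihi w = V}"

text \<open>\<open>Lo\<close> consumes an \<open>X\<close> of the first word, \<open>Hi\<close> a
  \<open>Y\<close> of the second, and \<open>Mi\<close> a \<open>Y\<close> and an \<open>X\<close>
  simultaneously. The first letters therefore force the next role, except when they are
  \<open>X\<close> and \<open>Y\<close>.\<close>

lemma merges_simps:
  "merges [] [] = {[]}"
  "merges [] (Y # V) = (#) Hi ` merges [] V"
  "merges (X # U) [] = (#) Lo ` merges U []"
  "merges (X # U) (X # V) = (#) Lo ` merges U (X # V)"
  "merges (X # U) (Y # V) = (#) Lo ` merges U (Y # V) \<union> (#) Hi ` merges (X # U) V"
  "merges (Y # U) (X # V) = (#) Mi ` merges U V"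
  "merges (Y # U) (Y # V) = (#) Hi ` merges (Y # U) V"
proof -
  have *: "[] \<in> merges U V \<longleftrightarrow> U = [] \<and> V = []"
    "Lo # w \<in> merges U V \<longleftrightarrow> (\<exists>U'. U = X # U' \<and> w \<in> merges U' V)"
    "Mi # w \<in> merges U V \<longleftrightarrow> (\<exists>U' V'. U = Y # U' \<and> V = X # V' \<and> w \<in> merges U' V')"
    "Hi # w \<in> merges U V \<longleftrightarrow> (\<exists>V'. V = Y # V' \<and> w \<in> merges U V')" for w U V
    by (auto simp: merges_def)
  have eqI: "S = S'" if "[] \<in> S \<longleftrightarrow> [] \<in> S'" "\<And>w. Lo # w \<in> S \<longleftrightarrow> Lo # w \<in> S'"
    "\<And>w. Mi # w \<in> S \<longleftrightarrow> Mi # w \<in> S'" "\<And>w. Hi # w \<in> S \<longleftrightarrow> Hi # w \<in> S'" for S S'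
  proof (rule set_eqI)
    show "w \<in> S \<longleftrightarrow> w \<in> S'" for w using that by (cases w rule: lomi.cases) simp_all
  qed
  show "merges [] [] = {[]}"
    "merges [] (Y # V) = (#) Hi ` merges [] V"
    "merges (X # U) [] = (#) Lo ` merges U []"
    "merges (X # U) (X # V) = (#) Lo ` merges U (X # V)"
    "merges (X # U) (Y # V) = (#) Lo ` merges U (Y # V) \<union> (#) Hi ` merges (X # U) V"
    "merges (Y # U) (X # V) = (#) Mi ` merges U V"
    "merges (Y # U) (Y # V) = (#) Hi ` merges (Y # U) V"
    by (rule eqI; auto simp: *)+
qed

definition gap_binoms :: "nat list \<Rightarrow> nat list \<Rightarrow> nat" where
  "gap_binoms ss rs = prod_list (map2 (\<lambda>s r. (s + r) choose r) ss rs)"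

lemma gap_binoms_Nil [simp]: "gap_binoms [] rs = 1"
  by (simp add: gap_binoms_def)

lemma gap_binoms_Cons [simp]:
  "gap_binoms (s # ss) (r # rs) = ((s + r) choose r) * gap_binoms ss rs"
  by (simp add: gap_binoms_def)

text \<open>The \<open>Y\<close>'s of \<open>U\<close> and the \<open>X\<close>'s of
  \<open>V\<close> are glued together as the letters \<open>Mi\<close>; within each slot between
  them a run of \<open>Lo\<close> and a run of \<open>Hi\<close> are shuffled freely. Induction on
  the total length works because each role shortens at least one word.\<close>

lemma card_merges:
  "count_list U Y = count_list V X \<Longrightarrow>
    finite (merges U V) \<and> card (merges U V) = gap_binoms (gaps Y U) (gaps X V)"
proof (induction "length U + length V" arbitrary: U V rule: less_induct)
  case less
  obtain s ss where s: "gaps Y (tl U) = s # ss" by (metis gaps_neq_Nil list.exhaust)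
  obtain r rs where r: "gaps X (tl V) = r # rs" by (metis gaps_neq_Nil list.exhaust)
  consider "U = []" "V = []" | V' where "U = []" "V = Y # V'" | U' where "U = X # U'" "V = []"
    | U' V' where "U = X # U'" "V = X # V'" | U' V' where "U = X # U'" "V = Y # V'"
    | U' V' where "U = Y # U'" "V = X # V'" | U' V' where "U = Y # U'" "V = Y # V'"
    using less.prems
    by (cases U; cases V; cases "hd U"; cases "hd V") auto
  then show ?case
  proof cases
    case 5
    have IH: "finite (merges U' V)" "card (merges U' V) = gap_binoms (gaps Y U') (gaps X V)"
      "finite (merges U V')" "card (merges U V') = gap_binoms (gaps Y U) (gaps X V')"
      using less.hyps[of U' V] less.hyps[of U V'] less.prems 5 by simp_all
    \<comment> \<open>The two branches differ in their first role. Since the leading runs are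
      \<open>Suc s\<close> and \<open>Suc r\<close>, their sum matches Pascal's rule for the first
      binomial.\<close>
    have "card (merges U V) = card (merges U' V) + card (merges U V')"
      using IH 5 by (simp add: merges_simps) (subst card_Un_disjoint; auto simp: card_image)
    then show ?thesis using IH 5 s r by (simp add: merges_simps algebra_simps)
  next
    case 2
    then show ?thesis using less.hyps[of "[]" V'] less.prems r
      by (auto simp: merges_simps card_image)
  next
    case 3
    then show ?thesis using less.hyps[of U' "[]"] less.prems s
      by (auto simp: merges_simps card_image)
  next
    case 4
    then show ?thesis using less.hyps[of U' V] less.prems s
      by (auto simp: merges_simps card_image)
  next
    case 6
    then show ?thesis using less.hyps[of U' V'] less.prems
      by (auto simp: merges_simps card_image)
  next
    case 7
    then show ?thesis using less.hyps[of U V'] less.prems r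
      by (auto simp: merges_simps card_image)
  qed (simp add: merges_simps)
qed

lemma card_merges_dyck:
  assumes D: "D \<in> dyck_words n" and "0 < n"
  shows "card (merges D D) = (\<Prod>i = 1..n - 1. (dyck_r i D + dyck_s i D) choose dyck_r i D)"
proof -
  have cnt: "count_list D X = n" "count_list D Y = n" using D by (auto simp: dyck_words_iff)
  let ?g = "\<lambda>i. (gaps Y D ! i + gaps X D ! i) choose (gaps X D ! i)"
  have "card (merges D D) = gap_binoms (gaps Y D) (gaps X D)" using card_merges[of D D] cnt by simp
  also have "\<dots> = (\<Prod>i<Suc n. ?g i)"
    by (simp add: gap_binoms_def prod.list_conv_set_nth cnt lessThan_atLeast0 del: prod.op_ivl_Suc)
  also have "\<dots> = (\<Prod>i = 1..n - 1. ?g i)"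
  proof (rule prod.mono_neutral_right)
    show "\<forall>i\<in>{..<Suc n} - {1..n - 1}. ?g i = 1"
    proof
      fix i assume "i \<in> {..<Suc n} - {1..n - 1}"
      then have "i = 0 \<or> i = n" by auto
      \<comment> \<open>For \<open>i = 0\<close> the lower entry of the binomial is 0; for
        \<open>i = n\<close> both entries agree.\<close>
      then show "?g i = 1" using dyck_gaps_ends[OF assms] by auto
    qed
  qed auto
  also have "\<dots> = (\<Prod>i = 1..n - 1. (dyck_r i D + dyck_s i D) choose dyck_r i D)"
  proof (rule prod.cong[OF refl])
    fix i assume "i \<in> {1..n - 1}"
    then obtain j where "i = Suc j" "Suc j < n" by (cases i) auto
    then show "?g i = (dyck_r i D + dyck_s i D) choose dyck_r i D"
      by (simp add: dyck_r_gaps dyck_s_gaps cnt add.commute)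
  qed
  finally show ?thesis .
qed

section \<open>321-avoidance\<close>

definition three_cyclic :: "nat \<Rightarrow> (nat \<Rightarrow> nat) \<Rightarrow> bool" where
  "three_cyclic N p \<longleftrightarrow> p permutes {1..N} \<and> (\<forall>x \<in> {1..N}. p x \<noteq> x \<and> p (p (p x)) = x)"

text \<open>Without fixed points the two classes of points compared here are the excedances and the
  deficiencies.\<close>

definition bimonotone :: "nat \<Rightarrow> (nat \<Rightarrow> nat) \<Rightarrow> bool" where
  "bimonotone N p \<longleftrightarrow>
    (\<forall>x \<in> {1..N}. \<forall>y \<in> {1..N}. x < y \<longrightarrow> (x < p x \<longleftrightarrow> y < p y) \<longrightarrow> p x < p y)"

lemma same_relative_order_321_iff:
  "same_relative_order ys [3, 2, 1] \<longleftrightarrow> (\<exists>a b c. ys = [a, b, c] \<and> c < b \<and> b < a)"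
proof
  assume H: "same_relative_order ys [3, 2, 1]"
  then have "length ys = 3" by (simp add: same_relative_order_def)
  then obtain a b c where ys: "ys = [a, b, c]"
    by (auto simp: numeral_3_eq_3 length_Suc_conv)
  have *: "ys ! i < ys ! j \<longleftrightarrow> [3, 2, 1::nat] ! i < [3, 2, 1] ! j" if "i < 3" "j < 3" for i j
    using H that \<open>length ys = 3\<close> unfolding same_relative_order_def by auto
  have "c < b" "b < a" using *[of 2 1] *[of 1 0] unfolding ys by simp_all
  then show "\<exists>a b c. ys = [a, b, c] \<and> c < b \<and> b < a" using ys by blast
next
  assume "\<exists>a b c. ys = [a, b, c] \<and> c < b \<and> b < a"
  then show "same_relative_order ys [3, 2, 1]"
    by (auto simp: same_relative_order_def less_Suc_eq numeral_3_eq_3)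
qed

lemma subseq_Cons_drop_iff:
  "subseq (y # ys) xs \<longleftrightarrow> (\<exists>i < length xs. xs ! i = y \<and> subseq ys (drop (Suc i) xs))"
proof
  assume "subseq (y # ys) xs"
  from list_emb_ConsD[OF this] obtain us vs where "xs = us @ y # vs" "subseq ys vs" by blast
  then show "\<exists>i < length xs. xs ! i = y \<and> subseq ys (drop (Suc i) xs)"
    by (intro exI[of _ "length us"]) simp
next
  assume "\<exists>i < length xs. xs ! i = y \<and> subseq ys (drop (Suc i) xs)"
  then obtain i where i: "i < length xs" "xs ! i = y" "subseq ys (drop (Suc i) xs)" by blast
  then have "subseq (y # ys) (take i xs @ y # drop (Suc i) xs)" by (intro list_emb_append2) auto
  then show "subseq (y # ys) xs" using id_take_nth_drop[OF i(1)] i(2) by metis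
qed

lemma avoids_321_iff:
  "avoids (one_line N p) [3, 2, 1] \<longleftrightarrow>
    \<not> (\<exists>i j k. 1 \<le> i \<and> i < j \<and> j < k \<and> k \<le> N \<and> p k < p j \<and> p j < p i)"
proof -
  \<comment> \<open>Peeling off the first entry of a subsequence confines the remaining entries to
    later indices; three such steps produce \<open>i < j < k\<close>.\<close>
  have one: "subseq (y # ys) (map p [a..<b]) \<longleftrightarrow>
      (\<exists>i. a \<le> i \<and> i < b \<and> p i = y \<and> subseq ys (map p [Suc i..<b]))" for y ys a b
  proof -
    have "subseq (y # ys) (map p [a..<b]) \<longleftrightarrow>
        (\<exists>i < b - a. p (a + i) = y \<and> subseq ys (map p [Suc (a + i)..<b]))"
      by (auto simp: subseq_Cons_drop_iff drop_map)
    also have "\<dots> \<longleftrightarrow> (\<exists>i. a \<le> i \<and> i < b \<and> p i = y \<and> subseq ys (map p [Suc i..<b]))"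
      by (metis le_add1 le_add_diff_inverse less_diff_conv2 add.commute less_diff_conv)
    finally show ?thesis .
  qed
  have "avoids (one_line N p) [3, 2, 1] \<longleftrightarrow>
      \<not> (\<exists>a b c. subseq [a, b, c] (map p [1..<Suc N]) \<and> c < b \<and> b < a)"
    unfolding avoids_def same_relative_order_321_iff one_line_def by blast
  moreover have "(\<exists>a b c. subseq [a, b, c] (map p [1..<Suc N]) \<and> c < b \<and> b < a) \<longleftrightarrow>
      (\<exists>i j k. 1 \<le> i \<and> i < j \<and> j < k \<and> k \<le> N \<and> p k < p j \<and> p j < p i)"
  proof
    assume "\<exists>a b c. subseq [a, b, c] (map p [1..<Suc N]) \<and> c < b \<and> b < a"
    then show "\<exists>i j k. 1 \<le> i \<and> i < j \<and> j < k \<and> k \<le> N \<and> p k < p j \<and> p j < p i"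
      unfolding one Suc_le_eq less_Suc_eq_le by blast
  next
    assume "\<exists>i j k. 1 \<le> i \<and> i < j \<and> j < k \<and> k \<le> N \<and> p k < p j \<and> p j < p i"
    then obtain i j k where ijk: "1 \<le> i" "i < j" "j < k" "k \<le> N" "p k < p j" "p j < p i" by blast
    have oneI: "subseq (p i # ys) (map p [a..<b])"
      if "a \<le> i" "i < b" "subseq ys (map p [Suc i..<b])" for ys a b i
      using that one by blast
    have "subseq [p i, p j, p k] (map p [1..<Suc N])"
      using ijk by (intro oneI) simp_all
    then show "\<exists>a b c. subseq [a, b, c] (map p [1..<Suc N]) \<and> c < b \<and> b < a" using ijk by blast
  qed
  ultimately show ?thesis by (simp only:)
qed

text \<open>The orbit of a point is as large as its least positive return time, so size 3 gives
  \<open>(p ^^ 3) x = x\<close>. Conversely the orbit is listed explicitly.\<close>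

lemma card_orbit_3_iff:
  assumes p: "p permutes S" and S: "finite S"
  shows "card (orbit p x) = 3 \<longleftrightarrow> p x \<noteq> x \<and> p (p (p x)) = x"
proof
  have perm: "permutation p" using p S permutation_permutes by blast
  assume card: "card (orbit p x) = 3"
  have self: "x \<in> orbit p x" using perm by (rule permutation_self_in_orbit)
  have "card (orbit p x) = card ((\<lambda>k. (p ^^ k) x) ` {0..<funpow_dist1 p x x})"
    using orbit_conv_funpow_dist1[OF self] by simp
  also have "\<dots> = funpow_dist1 p x x" using inj_on_funpow_dist1[OF self] by (simp add: card_image)
  finally have "funpow_dist1 p x x = 3" using card by simp
  then have "(p ^^ 3) x = x" using funpow_dist1_prop[OF self] by simp
  moreover have "orbit p x \<noteq> {x}" using card by auto
  ultimately show "p x \<noteq> x \<and> p (p (p x)) = x"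
    by (auto simp: orbit_eq_singleton_iff numeral_3_eq_3)
next
  assume x: "p x \<noteq> x \<and> p (p (p x)) = x"
  have "orbit p x = {p x, p (p x), x}"
  proof (intro equalityI subsetI)
    fix y assume "y \<in> orbit p x"
    then show "y \<in> {p x, p (p x), x}" by induction (use x in auto)
  next
    fix y assume "y \<in> {p x, p (p x), x}"
    then show "y \<in> orbit p x" using x by (metis insertE orbit.simps singletonD)
  qed
  moreover have "p (p x) \<noteq> p x" "p (p x) \<noteq> x" using x permutes_inj[OF p] by (metis injD)+
  ultimately show "card (orbit p x) = 3" using x by auto
qed

text \<open>Of the three points of a 321 pattern two have the same type, which contradicts
  monotonicity. Conversely a descent within one type extends to a 321 pattern.\<close>

lemma bimonotone_iff_no_321:
  assumes p: "p permutes {1..N}" and nofix: "\<And>x. x \<in> {1..N} \<Longrightarrow> p x \<noteq> x"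
  shows "bimonotone N p \<longleftrightarrow>
    \<not> (\<exists>i j k. 1 \<le> i \<and> i < j \<and> j < k \<and> k \<le> N \<and> p k < p j \<and> p j < p i)"
proof
  assume M: "bimonotone N p"
  show "\<not> (\<exists>i j k. 1 \<le> i \<and> i < j \<and> j < k \<and> k \<le> N \<and> p k < p j \<and> p j < p i)"
  proof clarify
    fix i j k assume ijk: "1 \<le> i" "i < j" "j < k" "k \<le> N" "p k < p j" "p j < p i"
    have "(i < p i) \<noteq> (j < p j)" "(i < p i) \<noteq> (k < p k)" "(j < p j) \<noteq> (k < p k)"
      using M ijk unfolding bimonotone_def by (meson atLeastAtMost_iff le_trans less_imp_le less_trans not_less_iff_gr_or_eq)+
    then show False by blast
  qed
next
  assume no: "\<not> (\<exists>i j k. 1 \<le> i \<and> i < j \<and> j < k \<and> k \<le> N \<and> p k < p j \<and> p j < p i)"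
  have inj: "inj_on p A" for A using permutes_inj[OF p] inj_on_subset by blast
  have inj': "p x = p y \<longleftrightarrow> x = y" for x y using permutes_inj[OF p] by (simp add: inj_eq)
  have im: "p x \<in> {1..N} \<longleftrightarrow> x \<in> {1..N}" for x using permutes_in_image[OF p] by blast
  show "bimonotone N p"
    unfolding bimonotone_def
  proof (intro ballI impI, rule ccontr)
    fix x y assume xy: "x \<in> {1..N}" "y \<in> {1..N}" "x < y" "(x < p x) = (y < p y)" "\<not> p x < p y"
    then have dec: "p y < p x" using inj'[of x y] by simp
    \<comment> \<open>By pigeonhole some value crosses back over the excedance (deficiency), completing a 321.\<close>
    show False
    proof (cases "y < p y")
      case True
      have "\<exists>z \<in> {Suc y..N}. p z \<le> y"
      proof (rule ccontr)
        assume "\<not> ?thesis"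
        then have "p z \<in> {Suc y..N}" if "z \<in> {Suc y..N}" for z
          using that im[of z] xy(1,2) by (auto simp: not_le Suc_le_eq)
        then have "p ` {Suc y..N} \<subseteq> {Suc y..N}" by blast
        then have "p ` {Suc y..N} = {Suc y..N}" using inj by (simp add: endo_inj_surj)
        moreover have "p y \<in> {Suc y..N}" using True im[of y] xy by auto
        ultimately obtain z where "z \<in> {Suc y..N}" "p z = p y" by (metis imageE)
        then show False using inj'[of z y] by auto
      qed
      then obtain z where "y < z" "z \<le> N" "p z \<le> y" by (auto simp: Suc_le_eq)
      moreover have "p z < p y" using True \<open>p z \<le> y\<close> by simp
      ultimately show False using no xy dec by (meson atLeastAtMost_iff)
    next
      case False
      then have "p x < x" using nofix[of x] xy by auto
      have "\<exists>z \<in> {1..<x}. x \<le> p z"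
      proof (rule ccontr)
        assume "\<not> ?thesis"
        then have "p z \<in> {1..<x}" if "z \<in> {1..<x}" for z
          using that im[of z] xy(1,2) by (auto simp: not_le Suc_le_eq)
        then have "p ` {1..<x} \<subseteq> {1..<x}" by blast
        then have "p ` {1..<x} = {1..<x}" using inj by (simp add: endo_inj_surj)
        moreover have "p x \<in> {1..<x}" using \<open>p x < x\<close> im[of x] xy by auto
        ultimately obtain z where "z \<in> {1..<x}" "p z = p x" by (metis imageE)
        then show False using inj'[of z x] by auto
      qed
      \<comment> \<open>For deficiencies the new point comes first: the pattern sits at
        \<open>z\<close>, \<open>x\<close>, \<open>y\<close>.\<close>
      then obtain z where "1 \<le> z" "z < x" "x \<le> p z" by auto
      moreover have "p x < p z" using \<open>p x < x\<close> \<open>x \<le> p z\<close> by simp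
      ultimately show False using no xy dec by (meson atLeastAtMost_iff)
    qed
  qed
qed

lemma Av_three_cycles_321_iff:
  "p \<in> Av_three_cycles N [3, 2, 1] \<longleftrightarrow> three_cyclic N p \<and> bimonotone N p"
proof -
  have "p \<in> perms_three_cycles N \<longleftrightarrow> three_cyclic N p"
    by (auto simp: perms_three_cycles_def three_cyclic_def card_orbit_3_iff)
  moreover have "avoids (one_line N p) [3, 2, 1] \<longleftrightarrow> bimonotone N p" if "three_cyclic N p"
    unfolding avoids_321_iff
    using that by (subst bimonotone_iff_no_321) (auto simp: three_cyclic_def)
  ultimately show ?thesis unfolding Av_three_cycles_def by blast
qed

section \<open>From words to permutations\<close>

lemma count_lomi: "count_list (lomi w) X = count_list w Lo" "count_list (lomi w) Y = count_list w Mi"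
  by (induction w rule: lomi.induct) auto

lemma count_mihi: "count_list (mihi w) X = count_list w Mi" "count_list (mihi w) Y = count_list w Hi"
  by (induction w rule: mihi.induct) auto

lemma length_roles: "length w = count_list w Lo + count_list w Mi + count_list w Hi"
  by (induction w rule: lomi.induct) auto

text \<open>Deleting the letters \<open>Hi\<close> preserves the relative order of the
  others.\<close>

lemma pos_lomi_less_iff:
  "i < count_list w Lo \<Longrightarrow> j < count_list w Mi \<Longrightarrow>
    pos X i (lomi w) < pos Y j (lomi w) \<longleftrightarrow> pos Lo i w < pos Mi j w"
  by (induction w arbitrary: i j rule: lomi.induct) (auto split: nat.splits)

lemma pos_mihi_less_iff:
  "i < count_list w Mi \<Longrightarrow> j < count_list w Hi \<Longrightarrow>
    pos X i (mihi w) < pos Y j (mihi w) \<longleftrightarrow> pos Mi i w < pos Hi j w"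
  by (induction w arbitrary: i j rule: mihi.induct) (auto split: nat.splits)

\<comment> \<open>Points of a permutation are 1-based, positions in a word 0-based.\<close>
definition place :: "role list \<Rightarrow> role \<Rightarrow> nat \<Rightarrow> nat" where
  "place w l i = Suc (pos l i w)"

definition balanced :: "nat \<Rightarrow> role list \<Rightarrow> bool" where
  "balanced n w \<longleftrightarrow> (\<forall>l. count_list w l = n)"

lemma balancedI: "count_list w Lo = n \<Longrightarrow> count_list w Mi = n \<Longrightarrow> count_list w Hi = n \<Longrightarrow> balanced n w"
  unfolding balanced_def by (metis role.exhaust)

lemma place_less_iff:
  "balanced n w \<Longrightarrow> i < n \<Longrightarrow> j < n \<Longrightarrow> place w l i < place w l j \<longleftrightarrow> i < j"
  by (simp add: place_def balanced_def pos_less_iff)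

lemma place_eq_iff:
  "balanced n w \<Longrightarrow> i < n \<Longrightarrow> j < n \<Longrightarrow> place w l i = place w m j \<longleftrightarrow> l = m \<and> i = j"
  by (simp add: place_def balanced_def pos_eq_iff)

lemma place_bij:
  assumes "balanced n w"
  shows "bij_betw (\<lambda>(l, i). place w l i) (UNIV \<times> {..<n}) {1..3 * n}"
proof (rule bij_betw_imageI)
  show "inj_on (\<lambda>(l, i). place w l i) (UNIV \<times> {..<n})"
    by (rule inj_onI) (auto simp: place_eq_iff[OF assms])
  have len: "length w = 3 * n" using assms by (simp add: length_roles balanced_def)
  show "(\<lambda>(l, i). place w l i) ` (UNIV \<times> {..<n}) = {1..3 * n}"
  proof (intro equalityI subsetI)
    fix x assume "x \<in> (\<lambda>(l, i). place w l i) ` (UNIV \<times> {..<n})"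
    then obtain l i where "i < n" "x = Suc (pos l i w)" by (auto simp: place_def)
    then show "x \<in> {1..3 * n}" using pos_less_length[of i w l] assms len by (simp add: balanced_def)
  next
    fix x assume x: "x \<in> {1..3 * n}"
    then have "x - 1 < length w" using len by auto
    then obtain i where "i < n" "x - 1 = pos (w ! (x - 1)) i w"
      using pos_onto assms unfolding balanced_def by metis
    then have "x = place w (w ! (x - 1)) i" using x by (simp add: place_def)
    then show "x \<in> (\<lambda>(l, i). place w l i) ` (UNIV \<times> {..<n})"
      using \<open>i < n\<close> by (intro image_eqI[of _ _ "(w ! (x - 1), i)"]) auto
  qed
qed

lemma place_in: "balanced n w \<Longrightarrow> i < n \<Longrightarrow> place w l i \<in> {1..3 * n}"
  using bij_betw_apply[OF place_bij, of n w "(l, i)"] by simp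

lemma place_cases:
  assumes "balanced n w" "x \<in> {1..3 * n}"
  obtains l i where "i < n" "x = place w l i"
proof -
  have "x \<in> (\<lambda>(l, i). place w l i) ` (UNIV \<times> {..<n})"
    using bij_betw_imp_surj_on[OF place_bij[OF assms(1)]] assms(2) by simp
  then show ?thesis using that by auto
qed

text \<open>The cycle with number \<open>i\<close> will consist of the points of index
  \<open>i\<close> of all three roles; the inequalities make the roles agree with their
  sizes.\<close>

definition layered :: "nat \<Rightarrow> role list \<Rightarrow> bool" where
  "layered n w \<longleftrightarrow> balanced n w \<and> (\<forall>i<n. place w Lo i < place w Mi i \<and> place w Mi i < place w Hi i)"

text \<open>The Dyck condition gives \<open>Lo\<close> before \<open>Mi\<close> at equal indices.
  Equality of the two subwords is, by \<open>letter_list_eqI\<close>, the agreement of all their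
  comparisons, and \<open>i = j\<close> then yields \<open>Mi\<close> before
  \<open>Hi\<close>.\<close>

lemma lomi_dyck_mihi_iff:
  "lomi w \<in> dyck_words n \<and> mihi w = lomi w \<longleftrightarrow> layered n w \<and>
    (\<forall>i<n. \<forall>j<n. place w Lo i < place w Mi j \<longleftrightarrow> place w Mi i < place w Hi j)" (is "?L \<longleftrightarrow> ?R")
proof
  assume L: ?L
  then have b: "balanced n w" using count_lomi[of w] count_mihi[of w]
    by (intro balancedI) (auto simp: dyck_words_iff)
  have less: "place w Lo i < place w Mi i" if "i < n" for i
    using L b that pos_lomi_less_iff[of i w i] by (auto simp: dyck_words_iff place_def balanced_def)
  have "place w Lo i < place w Mi j \<longleftrightarrow> place w Mi i < place w Hi j" if "i < n" "j < n" for i j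
    using L b that pos_lomi_less_iff[of i w j] pos_mihi_less_iff[of i w j]
    by (simp add: place_def balanced_def)
  then show ?R using less b by (auto simp: layered_def)
next
  assume R: ?R
  then have b: "balanced n w" by (simp add: layered_def)
  have D: "lomi w \<in> dyck_words n"
    using R b by (auto simp: dyck_words_iff count_lomi layered_def balanced_def pos_lomi_less_iff place_def)
  have "mihi w = lomi w"
    using R b by (intro letter_list_eqI)
      (auto simp: count_lomi count_mihi balanced_def place_def pos_lomi_less_iff pos_mihi_less_iff)
  then show ?L using D by simp
qed

\<comment> \<open>\<open>T\<close> collects the cycles running from minimum to middle element to maximum.\<close>
definition realizes :: "nat \<Rightarrow> role list \<Rightarrow> nat set \<Rightarrow> (nat \<Rightarrow> nat) \<Rightarrow> bool" where
  "realizes n w T p \<longleftrightarrow> p permutes {1..3 * n} \<and> (\<forall>i<n.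
    (i \<in> T \<longrightarrow> p (place w Lo i) = place w Mi i \<and> p (place w Mi i) = place w Hi i \<and> p (place w Hi i) = place w Lo i) \<and>
    (i \<notin> T \<longrightarrow> p (place w Lo i) = place w Hi i \<and> p (place w Hi i) = place w Mi i \<and> p (place w Mi i) = place w Lo i))"

lemma realizes_unique:
  assumes "balanced n w" "realizes n w T p" "realizes n w T q"
  shows "p = q"
proof
  fix x
  show "p x = q x"
  proof (cases "x \<in> {1..3 * n}")
    case True
    then obtain l i where "i < n" "x = place w l i" using place_cases assms(1) by blast
    then show ?thesis using assms(2,3) by (cases l; cases "i \<in> T") (auto simp: realizes_def)
  next
    case False
    then show ?thesis using assms(2,3) by (simp add: realizes_def permutes_def)
  qed
qed

fun next_role :: "role \<Rightarrow> role" where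
  "next_role Lo = Mi" | "next_role Mi = Hi" | "next_role Hi = Lo"

fun prev_role :: "role \<Rightarrow> role" where
  "prev_role Mi = Lo" | "prev_role Hi = Mi" | "prev_role Lo = Hi"

lemma prev_next_role [simp]: "prev_role (next_role l) = l" "next_role (prev_role l) = l"
  by (cases l; simp)+

lemma realizes_exists:
  assumes b: "balanced n w"
  shows "\<exists>p. realizes n w T p"
proof -
  let ?S = "UNIV \<times> {..<n}" and ?e = "\<lambda>(l, i). place w l i"
  \<comment> \<open>The permutation in coordinates: each cycle rotates its roles in the direction
    chosen by \<open>T\<close>. It is transported to points along \<open>place\<close>.\<close>
  let ?q = "\<lambda>(l, i). (if i \<in> T then next_role l else prev_role l, i)"
  let ?inv = "inv_into ?S ?e"
  define p where "p x = (if x \<in> {1..3 * n} then ?e (?q (?inv x)) else x)" for x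
  have e: "bij_betw ?e ?S {1..3 * n}" using place_bij[OF b] .
  have "bij_betw ?q ?S ?S"
    by (rule bij_betw_byWitness[where f' = "\<lambda>(l, i). (if i \<in> T then prev_role l else next_role l, i)"]) auto
  then have "bij_betw (?e \<circ> (?q \<circ> ?inv)) {1..3 * n} {1..3 * n}"
    by (intro bij_betw_trans[OF _ e] bij_betw_trans[OF bij_betw_inv_into[OF e]])
  then have "bij_betw p {1..3 * n} {1..3 * n}"
    by (rule bij_betw_cong[THEN iffD1, rotated]) (simp add: p_def)
  moreover have "p x = x" if "x \<notin> {1..3 * n}" for x
    using that unfolding p_def by (simp only: if_False)
  ultimately have perm: "p permutes {1..3 * n}" by (rule bij_imp_permutes)
  have val: "p (place w l i) = place w (if i \<in> T then next_role l else prev_role l) i" if "i < n" for l i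
    using bij_betw_inv_into_left[OF e, of "(l, i)"] place_in[OF b that, of l] that
    by (simp add: p_def)
  show ?thesis using perm by (intro exI[of _ p]) (simp add: realizes_def val)
qed

text \<open>The minimum is always an excedance and the maximum a deficiency, while the type of the
  middle element depends on the direction. Comparing two cycles type by type gives the equivalence
  for equal directions and separation for opposite ones.\<close>

lemma bimonotone_realizes_iff:
  assumes lay: "layered n w" and real: "realizes n w T p"
  shows "bimonotone (3 * n) p \<longleftrightarrow>
    (\<forall>i<n. \<forall>j<n. place w Lo i < place w Mi j \<longleftrightarrow> place w Mi i < place w Hi j) \<and>
    (\<forall>i j. i < j \<longrightarrow> j < n \<longrightarrow> (i \<in> T) \<noteq> (j \<in> T) \<longrightarrow> place w Mi i < place w Lo j)"
    (is "?M \<longleftrightarrow> ?E \<and> ?S")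
proof -
  let ?a = "place w Lo" and ?b = "place w Mi" and ?c = "place w Hi"
  have b: "balanced n w" using lay by (simp add: layered_def)
  have ord: "?a i < ?b i" "?b i < ?c i" if "i < n" for i using lay that by (auto simp: layered_def)
  have up: "p (?a i) = ?b i" "p (?b i) = ?c i" "p (?c i) = ?a i" if "i < n" "i \<in> T" for i
    using real that by (auto simp: realizes_def)
  have down: "p (?a i) = ?c i" "p (?c i) = ?b i" "p (?b i) = ?a i" if "i < n" "i \<notin> T" for i
    using real that by (auto simp: realizes_def)
  have inj: "p x = p y \<longleftrightarrow> x = y" for x y
    using real by (metis realizes_def permutes_inj injD)
  show ?thesis
  proof (intro iffI conjI)
    assume M: ?M
    \<comment> \<open>Monotonicity in both directions of the comparison, with injectivity, gives an
      order equivalence within each type.\<close>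
    have cmp: "x < y \<longleftrightarrow> p x < p y"
      if "x \<in> {1..3 * n}" "y \<in> {1..3 * n}" "x < p x \<longleftrightarrow> y < p y" for x y
      using M that inj[of x y] unfolding bimonotone_def by (metis linorder_neqE_nat order_less_asym)
    have P: "place w l i < place w m j \<longleftrightarrow> p (place w l i) < p (place w m j)"
      if "i < n" "j < n" "place w l i < p (place w l i) \<longleftrightarrow> place w m j < p (place w m j)" for l m i j
      using cmp that place_in[OF b] by blast
    \<comment> \<open>Two cycles of different orientation must be disjoint in the lower-middle word.\<close>
    have mixed: "(?b i < ?a j \<and> ?c i < ?b j) \<or> (?b j < ?a i \<and> ?c j < ?b i)"
      if "i < n" "j < n" "i \<in> T" "j \<notin> T" for i j
    proof -
      note v = up[OF that(1,3)] down[OF that(2,4)] ord[OF that(1)] ord[OF that(2)]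
      have neq: "i \<noteq> j" using that by blast
      \<comment> \<open>The order of the minima decides everything: \<open>?a i < ?a j\<close> gives
        \<open>?c i < ?b j\<close>, hence \<open>?a i < ?b j\<close>, hence
        \<open>?c i < ?c j\<close> and \<open>?b i < ?a j\<close>. The opposite order is treated by
        negating the same equivalences.\<close>
      have "?a i < ?a j \<longleftrightarrow> ?b i < ?c j" using P[of i j Lo Lo] v that by simp
      moreover have "?b i < ?a j \<longleftrightarrow> ?c i < ?c j" using P[of i j Mi Lo] v that by simp
      moreover have "?c i < ?c j \<longleftrightarrow> ?a i < ?b j" using P[of i j Hi Hi] v that by simp
      moreover have "?c i < ?b j \<longleftrightarrow> ?a i < ?a j" using P[of i j Hi Mi] v that by simp
      moreover have "?b i \<noteq> ?a j" "?c i \<noteq> ?b j" "?b j \<noteq> ?a i" "?c j \<noteq> ?b i"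
        using place_eq_iff[OF b] that neq by auto
      ultimately show ?thesis using v(7-10) by linarith
    qed
    show ?E
    proof (intro allI impI)
      fix i j assume ij: "i < n" "j < n"
      consider "i \<in> T" "j \<in> T" | "i \<notin> T" "j \<notin> T" | "i \<in> T" "j \<notin> T" | "i \<notin> T" "j \<in> T" by blast
      then show "?a i < ?b j \<longleftrightarrow> ?b i < ?c j"
      proof cases
        case 1
        then show ?thesis using P[of i j Lo Mi] up[OF ij(1)] up[OF ij(2)] ord[OF ij(1)] ord[OF ij(2)] ij by simp
      next
        case 2
        then show ?thesis using P[of i j Mi Hi] down[OF ij(1)] down[OF ij(2)] ord[OF ij(1)] ord[OF ij(2)] ij by simp
      next
        case 3
        then show ?thesis using mixed[OF ij] ord[OF ij(1)] ord[OF ij(2)] by linarith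
      next
        case 4
        then show ?thesis using mixed[OF ij(2,1)] ord[OF ij(1)] ord[OF ij(2)] by linarith
      qed
    qed
    show ?S
    proof (intro allI impI)
      fix i j assume ij: "i < j" "j < n" "(i \<in> T) \<noteq> (j \<in> T)"
      then have "i < n" by simp
      have "?a i < ?a j" using place_less_iff[OF b \<open>i < n\<close> ij(2)] ij by blast
      then show "?b i < ?a j"
        using mixed[OF \<open>i < n\<close> ij(2)] mixed[OF ij(2) \<open>i < n\<close>] ij ord[OF \<open>i < n\<close>] ord[OF ij(2)]
        by (cases "i \<in> T") force+
    qed
  next
    assume "?E \<and> ?S"
    then have E: "?a i < ?b j \<longleftrightarrow> ?b i < ?c j" if "i < n" "j < n" for i j using that by blast
    have S: "?b i < ?a j" if "i < j" "j < n" "(i \<in> T) \<noteq> (j \<in> T)" for i j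
      using \<open>?E \<and> ?S\<close> that by blast
    have S': "?c i < ?b j" if "i < j" "j < n" "(i \<in> T) \<noteq> (j \<in> T)" for i j
    proof -
      \<comment> \<open>Condition \<open>E\<close> is applied with the indices exchanged, where
        \<open>S\<close> refutes its left side.\<close>
      have "\<not> ?b j < ?c i" using S[OF that] E[of j i] that by simp
      moreover have "?b j \<noteq> ?c i" using place_eq_iff[OF b] that by simp
      ultimately show ?thesis by simp
    qed
    show ?M
      unfolding bimonotone_def
    proof (intro ballI impI)
      fix x y assume xy: "x \<in> {1..3 * n}" "y \<in> {1..3 * n}" "x < y" "(x < p x) = (y < p y)"
      obtain l i where x: "i < n" "x = place w l i" using place_cases[OF b xy(1)] .
      obtain m j where y: "j < n" "y = place w m j" using place_cases[OF b xy(2)] .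
      note o = ord[OF x(1)] ord[OF y(1)]
      note v = up[OF x(1)] up[OF y(1)] down[OF x(1)] down[OF y(1)]
      have same: "place w k i < place w k j \<longleftrightarrow> i < j" for k using place_less_iff[OF b x(1) y(1)] .
      have neq: "place w k i = place w k' j \<longleftrightarrow> k = k' \<and> i = j" for k k' using place_eq_iff[OF b x(1) y(1)] .
      have Eij: "?a i < ?b j \<longleftrightarrow> ?b i < ?c j" "?a j < ?b i \<longleftrightarrow> ?b j < ?c i" using E x(1) y(1) by auto
      consider "i \<in> T" "j \<in> T" | "i \<notin> T" "j \<notin> T" | "(i \<in> T) \<noteq> (j \<in> T)" by blast
      then show "p x < p y"
      proof cases
        case 1
        \<comment> \<open>Points of equal role are compared by index. Different roles of the same
          type are compared by \<open>Eij\<close>, and ties are excluded by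
          \<open>neq\<close>.\<close>
        show ?thesis
          using xy(3,4) o v(1-6) 1 Eij same[of Lo] same[of Mi] same[of Hi] neq[of Mi Hi] neq[of Hi Mi]
          unfolding x(2) y(2) by (cases l; cases m) auto
      next
        case 2
        show ?thesis
          using xy(3,4) o v(7-12) 2 Eij same[of Lo] same[of Mi] same[of Hi] neq[of Lo Mi] neq[of Mi Lo]
          unfolding x(2) y(2) by (cases l; cases m) auto
      next
        case 3
        then consider "i < j" | "j < i" by (metis linorder_neqE_nat)
        then show ?thesis
        proof cases
          case 1
          note s = S[OF 1 y(1) 3] S'[OF 1 y(1) 3]
          show ?thesis
            using xy(3,4) o v 3 s unfolding x(2) y(2) by (cases "i \<in> T"; cases l; cases m) simp_all
        next
          case 2
          note s = S[OF 2 x(1) not_sym[OF 3]] S'[OF 2 x(1) not_sym[OF 3]]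
          show ?thesis
            using xy(3,4) o v 3 s unfolding x(2) y(2) by (cases "i \<in> T"; cases l; cases m) simp_all
        qed
      qed
    qed
  qed
qed

section \<open>From permutations to words\<close>

lemma increasing_enum_unique:
  fixes f g :: "nat \<Rightarrow> nat"
  assumes "\<And>i j. i < j \<Longrightarrow> j < n \<Longrightarrow> f i < f j" "\<And>i j. i < j \<Longrightarrow> j < n \<Longrightarrow> g i < g j"
    and "f ` {..<n} = g ` {..<n}" "i < n"
  shows "f i = g i"
proof -
  have "map f [0..<n] = map g [0..<n]"
    using assms(1-3) by (intro strict_sorted_equal) (auto simp: sorted_wrt_iff_nth_less lessThan_atLeast0)
  then show ?thesis using assms(4) by (metis add_0 map_eq_conv atLeastLessThan_iff le0 set_upt)
qed

text \<open>On a 3-cycle this counts the other members of the cycle below \<open>x\<close>: none for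
  \<open>Lo\<close>, one for \<open>Mi\<close>, two for \<open>Hi\<close>.\<close>

definition role_of :: "(nat \<Rightarrow> nat) \<Rightarrow> nat \<Rightarrow> role" where
  "role_of p x = (if p x < x then if p (p x) < x then Hi else Mi
    else if p (p x) < x then Mi else Lo)"

definition role_word :: "nat \<Rightarrow> (nat \<Rightarrow> nat) \<Rightarrow> role list" where
  "role_word n p = map (role_of p) [1..<Suc (3 * n)]"

definition up_cycles :: "nat \<Rightarrow> role list \<Rightarrow> (nat \<Rightarrow> nat) \<Rightarrow> nat set" where
  "up_cycles n w p = {i. i < n \<and> p (place w Lo i) = place w Mi i}"

definition role_set :: "nat \<Rightarrow> (nat \<Rightarrow> nat) \<Rightarrow> role \<Rightarrow> nat set" where
  "role_set N p l = {x \<in> {1..N}. role_of p x = l}"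

lemma card_role_set: "card (role_set (3 * n) p l) = count_list (role_word n p) l"
proof -
  have count: "count_list (map f xs) l = length (filter (\<lambda>x. f x = l) xs)" for f :: "nat \<Rightarrow> role" and xs
    by (induction xs) auto
  have "count_list (role_word n p) l = length (filter (\<lambda>x. role_of p x = l) [1..<Suc (3 * n)])"
    unfolding role_word_def by (rule count)
  also have "\<dots> = card (set (filter (\<lambda>x. role_of p x = l) [1..<Suc (3 * n)]))"
    by (subst distinct_card) (simp_all del: upt_Suc)
  also have "set (filter (\<lambda>x. role_of p x = l) [1..<Suc (3 * n)]) = role_set (3 * n) p l"
    by (auto simp: role_set_def simp del: upt_Suc)
  finally show ?thesis by simp
qed

lemma place_role_word_image:
  assumes "balanced n (role_word n p)"
  shows "place (role_word n p) l ` {..<n} = role_set (3 * n) p l"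
proof -
  let ?w = "role_word n p"
  have nth: "?w ! k = role_of p (Suc k)" if "k < 3 * n" for k
    using that by (simp add: role_word_def del: upt_Suc)
  have role: "role_of p (place ?w l i) = l" if "i < n" for l i
  proof -
    have "pos l i ?w < 3 * n" using place_in[OF assms that, of l] by (simp add: place_def)
    moreover have "?w ! pos l i ?w = l" using nth_pos[of i ?w l] assms that by (simp add: balanced_def)
    ultimately show ?thesis using nth by (simp add: place_def)
  qed
  show ?thesis
  proof (intro equalityI subsetI)
    fix x assume "x \<in> place ?w l ` {..<n}"
    then show "x \<in> role_set (3 * n) p l" using role place_in[OF assms] by (auto simp: role_set_def)
  next
    fix x assume x: "x \<in> role_set (3 * n) p l"
    then obtain m i where "i < n" "x = place ?w m i"
      using place_cases[OF assms] unfolding role_set_def by blast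
    moreover from this have "m = l" using x role by (simp add: role_set_def)
    ultimately show "x \<in> place ?w l ` {..<n}" by simp
  qed
qed

text \<open>Intended for \<open>x\<close> the minimum of its 3-cycle: the smaller of the other two
  points is then the middle element.\<close>

definition cycle_mid :: "(nat \<Rightarrow> nat) \<Rightarrow> nat \<Rightarrow> nat" where "cycle_mid p x = min (p x) (p (p x))"

definition cycle_max :: "(nat \<Rightarrow> nat) \<Rightarrow> nat \<Rightarrow> nat" where "cycle_max p x = max (p x) (p (p x))"

lemma three_cyclicD:
  assumes "three_cyclic N p" "x \<in> {1..N}"
  shows "p x \<in> {1..N}" "p (p (p x)) = x" "p x \<noteq> x" "p (p x) \<noteq> p x" "p (p x) \<noteq> x"
proof -
  have perm: "p permutes {1..N}" using assms(1) by (simp add: three_cyclic_def)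
  show "p x \<in> {1..N}" using assms(2) by (simp only: permutes_in_image[OF perm])
  show c: "p (p (p x)) = x" and n: "p x \<noteq> x" using assms by (auto simp: three_cyclic_def)
  show "p (p x) \<noteq> p x" using n by (simp add: inj_eq[OF permutes_inj[OF perm]])
  show "p (p x) \<noteq> x" using c n by auto
qed

text \<open>The inverse is explicit: from the middle element or the maximum of a cycle, the minimum
  is the smaller of the other two points.\<close>

lemma role_set_mid_top:
  assumes p: "three_cyclic N p"
  shows "bij_betw (cycle_mid p) (role_set N p Lo) (role_set N p Mi)"
    and "bij_betw (cycle_max p) (role_set N p Lo) (role_set N p Hi)"
proof -
  note D = three_cyclicD[OF p]
  have inv: "x \<in> f p ` role_set N p Lo"
    if "x \<in> role_set N p l" "f = cycle_mid \<and> l = Mi \<or> f = cycle_max \<and> l = Hi" for x l f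
  proof -
    have x: "x \<in> {1..N}" "role_of p x = l" using that by (auto simp: role_set_def)
    note d = D[OF x(1)] D[OF D(1)[OF x(1)]]
    have "min (p x) (p (p x)) \<in> role_set N p Lo \<and> f p (min (p x) (p (p x))) = x"
      using that(2) x d
      by (auto simp: role_set_def role_of_def cycle_mid_def cycle_max_def min_def max_def split: if_splits)
    then show ?thesis by (metis image_eqI)
  qed
  have maps: "cycle_mid p x \<in> role_set N p Mi" "cycle_max p x \<in> role_set N p Hi"
    and low: "min (p (cycle_mid p x)) (p (p (cycle_mid p x))) = x" "min (p (cycle_max p x)) (p (p (cycle_max p x))) = x"
    if "x \<in> role_set N p Lo" for x
  proof -
    have x: "x \<in> {1..N}" "role_of p x = Lo" using that by (auto simp: role_set_def)
    note d = D[OF x(1)] D[OF D(1)[OF x(1)]]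
    show "cycle_mid p x \<in> role_set N p Mi" "cycle_max p x \<in> role_set N p Hi"
      "min (p (cycle_mid p x)) (p (p (cycle_mid p x))) = x" "min (p (cycle_max p x)) (p (p (cycle_max p x))) = x"
      using x d
      by (auto simp: role_set_def role_of_def cycle_mid_def cycle_max_def min_def max_def split: if_splits)
  qed
  show "bij_betw (cycle_mid p) (role_set N p Lo) (role_set N p Mi)"
    using maps inv[of _ Mi cycle_mid] low
    by (intro bij_betw_imageI inj_onI) (metis, auto)
  show "bij_betw (cycle_max p) (role_set N p Lo) (role_set N p Hi)"
    using maps inv[of _ Hi cycle_max] low
    by (intro bij_betw_imageI inj_onI) (metis, auto)
qed

lemma role_set_Lo_cases:
  assumes "three_cyclic N p" "x \<in> role_set N p Lo"
  obtains "x < cycle_mid p x" "cycle_mid p x < cycle_max p x" "p x = cycle_mid p x" "p (cycle_mid p x) = cycle_max p x" "p (cycle_max p x) = x"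
  | "x < cycle_mid p x" "cycle_mid p x < cycle_max p x" "p x = cycle_max p x" "p (cycle_max p x) = cycle_mid p x" "p (cycle_mid p x) = x"
proof -
  have x: "x \<in> {1..N}" "role_of p x = Lo" using assms by (auto simp: role_set_def)
  note d = three_cyclicD[OF assms(1) x(1)]
  have "\<not> p x < x" "\<not> p (p x) < x" using x(2) by (auto simp: role_of_def split: if_splits)
  then have less: "x < p x" "x < p (p x)" using d by auto
  show ?thesis
  proof (cases "p x < p (p x)")
    case True
    then have "cycle_mid p x = p x" "cycle_max p x = p (p x)" by (auto simp: cycle_mid_def cycle_max_def)
    then show ?thesis by (intro that(1)) (simp_all only: less d True)
  next
    case False
    then have gt: "p (p x) < p x" using d(4) by simp
    then have "cycle_mid p x = p (p x)" "cycle_max p x = p x" by (simp_all add: cycle_mid_def cycle_max_def)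
    then show ?thesis by (intro that(2)) (simp_all only: less d gt)
  qed
qed

text \<open>For equal directions the inequality of the minima is pushed once or twice through
  \<open>p\<close>. For opposite directions the cycles come out fully separated above their
  minima.\<close>

lemma mid_top_increasing:
  assumes p: "three_cyclic N p" and M: "bimonotone N p"
    and x: "x \<in> role_set N p Lo" and y: "y \<in> role_set N p Lo" and less: "x < y"
  shows "cycle_mid p x < cycle_mid p y \<and> cycle_max p x < cycle_max p y"
proof -
  have in_range: "z \<in> {1..N} \<and> cycle_mid p z \<in> {1..N} \<and> cycle_max p z \<in> {1..N}" if "z \<in> role_set N p Lo" for z
    using that bij_betw_apply[OF role_set_mid_top(1)[OF p] that] bij_betw_apply[OF role_set_mid_top(2)[OF p] that]
    by (simp add: role_set_def)
  have M': "u < v \<Longrightarrow> p u < p v"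
    if "u \<in> {1..N}" "v \<in> {1..N}" "u < p u \<longleftrightarrow> v < p v" for u v
    using M that by (auto simp: bimonotone_def)
  note r = in_range[OF x] in_range[OF y]
  have neq: "cycle_mid p x \<noteq> cycle_max p y" "cycle_max p x \<noteq> cycle_mid p y" "cycle_mid p x \<noteq> cycle_mid p y" "cycle_max p x \<noteq> cycle_max p y"
  proof -
    note b = bij_betw_apply[OF role_set_mid_top(1)[OF p]] bij_betw_apply[OF role_set_mid_top(2)[OF p]]
    show "cycle_mid p x \<noteq> cycle_max p y" "cycle_max p x \<noteq> cycle_mid p y" using b[OF x] b[OF y] by (auto simp: role_set_def)
    show "cycle_mid p x \<noteq> cycle_mid p y" "cycle_max p x \<noteq> cycle_max p y"
      using x y less role_set_mid_top[OF p] by (auto simp: bij_betw_def inj_on_def)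
  qed
  show ?thesis
  proof (cases rule: role_set_Lo_cases[OF p x])
    case 1
    note x1 = 1
    show ?thesis
    proof (cases rule: role_set_Lo_cases[OF p y])
      case 1
      have "cycle_mid p x < cycle_mid p y" using M'[of x y] r 1 x1 less by simp
      then show ?thesis using M'[of "cycle_mid p x" "cycle_mid p y"] r 1 x1 by simp
    next
      case 2
      have "cycle_mid p x < cycle_max p y" using M'[of x y] r 2 x1 less by simp
      \<comment> \<open>Both points are deficiencies and are sent to \<open>y\<close> and
        \<open>x\<close>, so this inequality would force \<open>y < x\<close>.\<close>
      moreover have "\<not> cycle_mid p y < cycle_max p x" using M'[of "cycle_mid p y" "cycle_max p x"] r 2 x1 less by auto
      ultimately show ?thesis using neq 2 x1 by linarith
    qed
  next
    case 2
    note x2 = 2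
    show ?thesis
    proof (cases rule: role_set_Lo_cases[OF p y])
      case 1
      have "cycle_max p x < cycle_mid p y" using M'[of x y] r 1 x2 less by simp
      then show ?thesis using 1 x2 by linarith
    next
      case 2
      have "cycle_max p x < cycle_max p y" using M'[of x y] r 2 x2 less by simp
      then show ?thesis using M'[of "cycle_max p x" "cycle_max p y"] r 2 x2 by simp
    qed
  qed
qed

text \<open>The mates of the increasing minima form an increasing enumeration of all middle
  elements, and likewise of all maxima. By uniqueness of such enumerations the points of index
  \<open>i\<close> make up one cycle.\<close>

lemma role_word_realizes:
  assumes p: "three_cyclic (3 * n) p" and M: "bimonotone (3 * n) p"
  shows "layered n (role_word n p)"
    and "realizes n (role_word n p) (up_cycles n (role_word n p) p) p"
proof -
  let ?w = "role_word n p" and ?R = "role_set (3 * n) p"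
  have "count_list ?w Mi = count_list ?w Lo" "count_list ?w Hi = count_list ?w Lo"
    unfolding card_role_set[symmetric] using role_set_mid_top[OF p] bij_betw_same_card by metis+
  moreover have "length ?w = 3 * n" by (simp add: role_word_def)
  ultimately have b: "balanced n ?w" by (intro balancedI) (use length_roles[of ?w] in auto)
  have Lo: "place ?w Lo i \<in> ?R Lo" if "i < n" for i
    using place_role_word_image[OF b, of Lo] that by auto
  have mid: "cycle_mid p (place ?w Lo i) = place ?w Mi i" and top: "cycle_max p (place ?w Lo i) = place ?w Hi i"
    if "i < n" for i
  proof -
    have img: "f p ` place ?w Lo ` {..<n} = place ?w l ` {..<n}"
      if "bij_betw (f p) (?R Lo) (?R l)" for f l
      using that by (simp add: place_role_word_image[OF b] bij_betw_def)
    show "cycle_mid p (place ?w Lo i) = place ?w Mi i"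
    proof (rule increasing_enum_unique[OF _ _ _ that, of "\<lambda>i. cycle_mid p (place ?w Lo i)"])
      show "(\<lambda>i. cycle_mid p (place ?w Lo i)) ` {..<n} = place ?w Mi ` {..<n}"
        using img[of cycle_mid Mi] role_set_mid_top[OF p] by (simp add: image_image)
    qed (use mid_top_increasing[OF p M Lo Lo] place_less_iff[OF b] in auto)
    show "cycle_max p (place ?w Lo i) = place ?w Hi i"
    proof (rule increasing_enum_unique[OF _ _ _ that, of "\<lambda>i. cycle_max p (place ?w Lo i)"])
      show "(\<lambda>i. cycle_max p (place ?w Lo i)) ` {..<n} = place ?w Hi ` {..<n}"
        using img[of cycle_max Hi] role_set_mid_top[OF p] by (simp add: image_image)
    qed (use mid_top_increasing[OF p M Lo Lo] place_less_iff[OF b] in auto)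
  qed
  have ord: "place ?w Lo i < place ?w Mi i \<and> place ?w Mi i < place ?w Hi i" if "i < n" for i
    using mid[OF that] top[OF that] by (cases rule: role_set_Lo_cases[OF p Lo[OF that]]) auto
  then show "layered n ?w" using b by (simp add: layered_def)
  have "p permutes {1..3 * n}" using p by (simp add: three_cyclic_def)
  moreover have "(i \<in> up_cycles n ?w p \<longrightarrow> p (place ?w Lo i) = place ?w Mi i \<and>
        p (place ?w Mi i) = place ?w Hi i \<and> p (place ?w Hi i) = place ?w Lo i) \<and>
      (i \<notin> up_cycles n ?w p \<longrightarrow> p (place ?w Lo i) = place ?w Hi i \<and>
        p (place ?w Hi i) = place ?w Mi i \<and> p (place ?w Mi i) = place ?w Lo i)" if "i < n" for i
    using mid[OF that] top[OF that] ord[OF that] that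
    by (cases rule: role_set_Lo_cases[OF p Lo[OF that]]) (auto simp: up_cycles_def)
  ultimately show "realizes n ?w (up_cycles n ?w p) p" by (simp add: realizes_def)
qed

lemma realizes_three_cyclic:
  assumes lay: "layered n w" and real: "realizes n w T p" and T: "T \<subseteq> {..<n}"
  shows "three_cyclic (3 * n) p" "role_word n p = w" "up_cycles n w p = T"
proof -
  have b: "balanced n w" using lay by (simp add: layered_def)
  have ord: "place w Lo i < place w Mi i" "place w Mi i < place w Hi i" if "i < n" for i
    using lay that by (auto simp: layered_def)
  have up: "p (place w Lo i) = place w Mi i" "p (place w Mi i) = place w Hi i" "p (place w Hi i) = place w Lo i"
    if "i < n" "i \<in> T" for i using real that by (auto simp: realizes_def)
  have down: "p (place w Lo i) = place w Hi i" "p (place w Hi i) = place w Mi i" "p (place w Mi i) = place w Lo i"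
    if "i < n" "i \<notin> T" for i using real that by (auto simp: realizes_def)
  have cyc: "p (place w l i) \<noteq> place w l i \<and> p (p (p (place w l i))) = place w l i"
    and role: "role_of p (place w l i) = l" if "i < n" for i l
    using ord[OF that] up[OF that] down[OF that]
    by (cases "i \<in> T"; cases l; simp add: role_of_def)+
  show "three_cyclic (3 * n) p"
    unfolding three_cyclic_def
  proof (intro conjI ballI)
    show "p permutes {1..3 * n}" using real by (simp add: realizes_def)
  next
    fix x assume "x \<in> {1..3 * n}"
    then show "p x \<noteq> x" using place_cases[OF b] cyc by metis
  next
    fix x assume "x \<in> {1..3 * n}"
    then show "p (p (p x)) = x" using place_cases[OF b] cyc by metis
  qed
  show "role_word n p = w"
  proof (rule nth_equalityI)
    show len: "length (role_word n p) = length w"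
      using b length_roles[of w] by (simp add: role_word_def balanced_def)
    fix k assume "k < length (role_word n p)"
    then have k: "k < 3 * n" "k < length w" using len by (simp_all add: role_word_def del: upt_Suc)
    obtain i where i: "i < n" "k = pos (w ! k) i w"
      using pos_onto[OF k(2)] b unfolding balanced_def by metis
    have "role_word n p ! k = role_of p (Suc k)" using k by (simp add: role_word_def del: upt_Suc)
    also have "Suc k = place w (w ! k) i" unfolding place_def using i(2) by (rule arg_cong)
    finally show "role_word n p ! k = w ! k" using role[OF i(1)] by simp
  qed
  show "up_cycles n w p = T"
  proof (intro equalityI subsetI)
    fix i assume "i \<in> up_cycles n w p"
    then have "i < n" "p (place w Lo i) = place w Mi i" by (auto simp: up_cycles_def)
    then show "i \<in> T" using down(1)[of i] ord(2)[of i] by (cases "i \<in> T") auto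
  next
    fix i assume "i \<in> T"
    then show "i \<in> up_cycles n w p" using T up(1)[of i] by (auto simp: up_cycles_def)
  qed
qed

section \<open>The bijection with Dyck words, merges and switchings, and the final count\<close>

definition returns :: "nat \<Rightarrow> letter list \<Rightarrow> nat set" where
  "returns n D = {i. Suc i < n \<and> pos Y i D < pos X (Suc i) D}"

text \<open>A change of direction between distant cycles includes a change between two neighbours
  \<open>k\<close> and \<open>Suc k\<close>; the separation there extends to \<open>i\<close> and
  \<open>j\<close> because \<open>place\<close> increases in the index.\<close>

lemma switchings_returns_iff:
  assumes w: "lomi w \<in> dyck_words n \<and> mihi w = lomi w" and T: "T \<subseteq> {..<n}"
  shows "T \<in> switchings n (returns n (lomi w)) \<longleftrightarrow>
    (\<forall>i j. i < j \<longrightarrow> j < n \<longrightarrow> (i \<in> T) \<noteq> (j \<in> T) \<longrightarrow> place w Mi i < place w Lo j)" (is "?L \<longleftrightarrow> ?R")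
proof -
  have b: "balanced n w" using w lomi_dyck_mihi_iff by (simp add: layered_def)
  have ret: "i \<in> returns n (lomi w) \<longleftrightarrow> place w Mi i < place w Lo (Suc i)" if "Suc i < n" for i
    using that b pos_lomi_less_iff[of "Suc i" w i] pos_eq_iff[of "Suc i" "lomi w" X i Y]
      pos_eq_iff[of "Suc i" w Lo i Mi]
    by (auto simp: returns_def place_def balanced_def count_lomi)
  show ?thesis
  proof
    assume ?R
    then show ?L using T ret unfolding switchings_def by (simp, metis lessI)
  next
    assume ?L
    show ?R
    proof (intro allI impI)
      fix i j assume ij: "i < j" "j < n" "(i \<in> T) \<noteq> (j \<in> T)"
      have "\<exists>k. i \<le> k \<and> k < j \<and> (k \<in> T) \<noteq> (Suc k \<in> T)"
        using ij(1,3)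
      proof (induction j)
        case (Suc j)
        show ?case
        proof (cases "(j \<in> T) = (Suc j \<in> T)")
          case True
          then have "i \<noteq> j" using Suc.prems(2) by blast
          then have "i < j" using Suc.prems(1) by simp
          then show ?thesis using Suc.IH Suc.prems(2) True less_SucI by blast
        next
          case False
          then show ?thesis using Suc.prems(1) by (intro exI[of _ j]) simp
        qed
      qed simp
      then obtain k where k: "i \<le> k" "k < j" "(k \<in> T) \<noteq> (Suc k \<in> T)" by blast
      have "Suc k < n" using k(2) ij(2) by simp
      then have "k \<in> returns n (lomi w)" using \<open>?L\<close> k(3) by (simp add: switchings_def) blast
      then have "place w Mi k < place w Lo (Suc k)" using ret k ij by simp
      moreover have "place w Mi i \<le> place w Mi k" "place w Lo (Suc k) \<le> place w Lo j"
        using place_less_iff[OF b, of k i, THEN arg_cong[of _ _ Not]]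
          place_less_iff[OF b, of j "Suc k", THEN arg_cong[of _ _ Not]] k ij by (simp_all add: not_less)
      ultimately show "place w Mi i < place w Lo j" by simp
    qed
  qed
qed

text \<open>The first component is determined by \<open>w\<close> and serves to sort the
  permutations by Dyck word. Injectivity is the uniqueness of realizations; surjectivity is their
  existence together with the recovery of word and directions.\<close>

lemma bij_Av_three_cycles:
  "bij_betw (\<lambda>p. let w = role_word n p in (lomi w, w, up_cycles n w p)) (Av_three_cycles (3 * n) [3, 2, 1])
    (SIGMA D : dyck_words n. merges D D \<times> switchings n (returns n D))"
    (is "bij_betw ?f ?A ?B")
proof (rule bij_betw_imageI)
  have A: "layered n (role_word n p)" "realizes n (role_word n p) (up_cycles n (role_word n p) p) p"
    "bimonotone (3 * n) p" if "p \<in> ?A" for p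
    using that role_word_realizes unfolding Av_three_cycles_321_iff by auto
  show "inj_on ?f ?A"
  proof (rule inj_onI)
    fix p q assume pq: "p \<in> ?A" "q \<in> ?A" "?f p = ?f q"
    have "role_word n p = role_word n q"
      "up_cycles n (role_word n p) p = up_cycles n (role_word n q) q"
      using pq(3) unfolding Let_def prod.inject by blast+
    then show "p = q"
      using A(1,2)[OF pq(1)] A(2)[OF pq(2)] realizes_unique unfolding layered_def by metis
  qed
  have B: "(lomi w, w, T) \<in> ?B \<longleftrightarrow> (lomi w \<in> dyck_words n \<and> mihi w = lomi w) \<and>
      T \<in> switchings n (returns n (lomi w))" for w T
    by (auto simp: merges_def)
  \<comment> \<open>Both sides reduce to the same two conditions: equal comparisons in the two
    subwords, and separation of cycles with opposite directions.\<close>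
  have B': "(lomi w, w, T) \<in> ?B \<longleftrightarrow> bimonotone (3 * n) p"
    if "layered n w" "realizes n w T p" "T \<subseteq> {..<n}" for w T p
  proof -
    have "T \<in> switchings n (returns n (lomi w)) \<longleftrightarrow>
        (\<forall>i j. i < j \<longrightarrow> j < n \<longrightarrow> (i \<in> T) \<noteq> (j \<in> T) \<longrightarrow> place w Mi i < place w Lo j)"
      if "lomi w \<in> dyck_words n \<and> mihi w = lomi w"
      using switchings_returns_iff[OF that \<open>T \<subseteq> {..<n}\<close>] .
    then show ?thesis
      unfolding B bimonotone_realizes_iff[OF that(1,2)] using lomi_dyck_mihi_iff[of w n] that(1) by blast
  qed
  show "?f ` ?A = ?B"
  proof (intro equalityI subsetI)
    fix z assume "z \<in> ?f ` ?A"
    then obtain p where p: "p \<in> ?A" "z = ?f p" by blast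
    then show "z \<in> ?B"
      using B'[OF A(1,2)[OF p(1)]] A(3)[OF p(1)] by (auto simp: Let_def up_cycles_def)
  next
    fix z assume "z \<in> ?B"
    then obtain w T where z: "z = (lomi w, w, T)" by (auto simp: merges_def)
    then have wT: "lomi w \<in> dyck_words n \<and> mihi w = lomi w" "T \<subseteq> {..<n}"
      using \<open>z \<in> ?B\<close> B by (auto simp: switchings_def)
    then have lay: "layered n w" using lomi_dyck_mihi_iff by blast
    then obtain p where p: "realizes n w T p" using realizes_exists unfolding layered_def by blast
    note r = realizes_three_cyclic[OF lay p wT(2)]
    have "p \<in> ?A" using r(1) B'[OF lay p wT(2)] \<open>z \<in> ?B\<close> unfolding z Av_three_cycles_321_iff by blast
    moreover have "?f p = z" using r z by (simp add: Let_def)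
    ultimately show "z \<in> ?f ` ?A" by blast
  qed
qed

theorem theorem4p13:
  fixes n :: nat
  assumes "n \<ge> 1"
  shows "card (Av_three_cycles (3 * n) [3, 2, 1]) =
    (\<Sum>D \<in> dyck_words n. 2 ^ dyck_h D * (\<Prod>i = 1..n - 1. (dyck_r i D + dyck_s i D) choose dyck_r i D))"
proof -
  have n: "0 < n" using assms by simp
  have fin: "finite (merges D D)" if "D \<in> dyck_words n" for D
    using card_merges[of D D] that by (simp add: dyck_words_iff)
  have card_sw: "card (switchings n (returns n D)) = 2 ^ dyck_h D" if "D \<in> dyck_words n" for D
  proof -
    obtain m where m: "n = Suc m" using n by (cases n) auto
    \<comment> \<open>The cuts are the returns before the end of \<open>D\<close>. The return at the
      end corresponds to the extra factor 2 of the first block, so the exponents agree.\<close>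
    have "{i. i < m \<and> i \<in> returns n D} = returns n D" by (auto simp: returns_def m)
    then show ?thesis
      using card_switchings[of m "returns n D"] dyck_h_conv[OF that n] by (simp add: m returns_def)
  qed
  have "card (Av_three_cycles (3 * n) [3, 2, 1]) =
      card (SIGMA D : dyck_words n. merges D D \<times> switchings n (returns n D))"
    by (rule bij_betw_same_card[OF bij_Av_three_cycles])
  also have "\<dots> = (\<Sum>D \<in> dyck_words n. card (merges D D \<times> switchings n (returns n D)))"
    by (rule card_SigmaI) (simp_all add: finite_dyck_words fin finite_switchings)
  also have "\<dots> = (\<Sum>D \<in> dyck_words n. 2 ^ dyck_h D * (\<Prod>i = 1..n - 1. (dyck_r i D + dyck_s i D) choose dyck_r i D))"
    by (rule sum.cong[OF refl]) (simp add: card_cartesian_product card_sw card_merges_dyck[OF _ n])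
  finally show ?thesis .
qed

end
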